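(* Let $\varphi\in\mathbb{L}^{\ge 3}(x,y)$ and let $k>1$ be any integer. Then: (1) $\mathrm{pent}(\varphi)=0\Rightarrow \mathrm{pent}^k(\varphi)=0\Rightarrow \mathrm{pent}^{k-1}(\varphi)=0$. (2) $\mathrm{pent}^k_{dmr}(\varphi)=0\Rightarrow \mathrm{pent}^{k-1}_{dmr}(\varphi)=0$. (3) $\mathrm{pent}^k_{krv}(\varphi)=0\Rightarrow \mathrm{pent}^{k-1}_{krv}(\varphi)=0$. (4) $\mathrm{pent}^k(\varphi)=0\Rightarrow \mathrm{pent}^k_{dmr}(\varphi)=0\Rightarrow \mathrm{pent}^k_{krv}(\varphi)=0$.
   Context: Work over a field of characteristic $0$. $\mathbb{L}(x,y)$ is the free Lie algebra on $x,y$, graded by $\deg x=\deg y=1$, and $\mathbb{L}^{\ge 3}(x,y)$ is the span of its homogeneous elements of degree $\ge 3$. $\mathfrak{t}_n$ (Drinfeld–Kohno Lie algebra) is generated by $t_{ij}$, $1\le i,j\le n$, with $t_{ij}=t_{ji}$, $t_{ii}=0$, and relations $[t_{ij},t_{kl}]=0$ for $i,j,k,l$ distinct, $[t_{ij},t_{ik}+t_{jk}]=0$ for $i,j,k$ distinct. For $1\le i\le n$, $\mathrm{pr}^i_n:\mathfrak{t}_n\to\mathfrak{t}_{n-1}$ is the Lie algebra morphism sending $t_{il}\mapsto 0$ for all $l$ and $t_{kl}\mapsto t_{kl}$ for $k,l\ne i$ (the indices $\{1,\dots,n\}\setminus\{i\}$ being relabelled in increasing order). Set $\mathfrak{brun}_4(D)=\bigcap_{i=1}^4\ker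 \mathrm{pr}^i_4$, $\mathfrak{brun}_{1,3}(D)=\bigcap_{i=2}^4\ker\mathrm{pr}^i_4$, $\mathfrak{brun}_{2,2}(D)=\ker\mathrm{pr}^3_4\cap\ker\mathrm{pr}^4_4$, all Lie subalgebras of $\mathfrak{t}_4$. For $\varphi\in\mathbb{L}(x,y)$ put $$\mathrm{pent}(\varphi)=\varphi(t_{12},t_{23})+\varphi(t_{12}+t_{13},t_{24}+t_{34})+\varphi(t_{23},t_{34})-\varphi(t_{13}+t_{23},t_{34})-\varphi(t_{12},t_{23}+t_{24})\in\mathfrak{t}_4 .$$ When $\varphi$ has no terms of degree $\le 1$, this element lies in $\mathfrak{brun}_4(D)\subset\mathfrak{brun}_{1,3}(D)\subset\mathfrak{brun}_{2,2}(D)$. For a Lie algebra $\mathfrak{g}$ put $\Gamma_1(\mathfrak{g})=[\mathfrak{g},\mathfrak{g}]$ and $\Gamma_{k+1}(\mathfrak{g})=[\mathfrak{g},\Gamma_k(\mathfrak{g})]$ for $k\ge1$. For $k\ge 1$, $\mathrm{pent}^k(\varphi)$, $\mathrm{pent}^k_{dmr}(\varphi)$, $\mathrm{pent}^k_{krv}(\varphi)$ denote the classes of $\mathrm{pent}(\varphi)$ in $\mathfrak{brun}_4(D)/\Gamma_k(\mathfrak{brun}_4(D))$, $\mathfrak{brun}_{1,3}(D)/\Gamma_k(\mathfrak{brun}_{1,3}(D))$ and $\mathfrak{brun}_{2,2}(D)/\Gamma_k(\mathfrak{brun}_{2,2}(D))$ respectively. *)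

theory Defs
  imports HOL.Hull "HOL-Algebra.Module" "HOL-Algebra.QuotRing"
begin

section \<open>Lie algebras\<close>

text \<open>
  A Lie algebra over K is a record of type \<open>('k, 'v) module\<close> whose multiplication
  is the Lie bracket: \<open>u \<otimes>\<^bsub>L\<^esub> v\<close> stands for $[u,v]$. The unit slot of the record
  carries no meaning and is left undefined.
\<close>

locale lie_algebra = module K L
  for K :: "('k, 'm) ring_scheme" (structure) and L :: "('k, 'v) module" (structure) +
  assumes bracket_closed:
      "\<lbrakk>u \<in> carrier L; v \<in> carrier L\<rbrakk> \<Longrightarrow> u \<otimes>\<^bsub>L\<^esub> v \<in> carrier L"
    and bracket_add_left:
      "\<lbrakk>u \<in> carrier L; v \<in> carrier L; w \<in> carrier L\<rbrakk>
        \<Longrightarrow> (u \<oplus>\<^bsub>L\<^esub> v) \<otimes>\<^bsub>L\<^esub> w = u \<otimes>\<^bsub>L\<^esub> w \<oplus>\<^bsub>L\<^esub> v \<otimes>\<^bsub>L\<^esub> w"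
    and bracket_add_right:
      "\<lbrakk>u \<in> carrier L; v \<in> carrier L; w \<in> carrier L\<rbrakk>
        \<Longrightarrow> u \<otimes>\<^bsub>L\<^esub> (v \<oplus>\<^bsub>L\<^esub> w) = u \<otimes>\<^bsub>L\<^esub> v \<oplus>\<^bsub>L\<^esub> u \<otimes>\<^bsub>L\<^esub> w"
    and bracket_smult_left:
      "\<lbrakk>a \<in> carrier K; u \<in> carrier L; v \<in> carrier L\<rbrakk>
        \<Longrightarrow> (a \<odot>\<^bsub>L\<^esub> u) \<otimes>\<^bsub>L\<^esub> v = a \<odot>\<^bsub>L\<^esub> (u \<otimes>\<^bsub>L\<^esub> v)"
    and bracket_smult_right:
      "\<lbrakk>a \<in> carrier K; u \<in> carrier L; v \<in> carrier L\<rbrakk>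
        \<Longrightarrow> u \<otimes>\<^bsub>L\<^esub> (a \<odot>\<^bsub>L\<^esub> v) = a \<odot>\<^bsub>L\<^esub> (u \<otimes>\<^bsub>L\<^esub> v)"
    and bracket_self: "u \<in> carrier L \<Longrightarrow> u \<otimes>\<^bsub>L\<^esub> u = \<zero>\<^bsub>L\<^esub>"
    and jacobi:
      "\<lbrakk>u \<in> carrier L; v \<in> carrier L; w \<in> carrier L\<rbrakk>
        \<Longrightarrow> u \<otimes>\<^bsub>L\<^esub> (v \<otimes>\<^bsub>L\<^esub> w) \<oplus>\<^bsub>L\<^esub> v \<otimes>\<^bsub>L\<^esub> (w \<otimes>\<^bsub>L\<^esub> u) \<oplus>\<^bsub>L\<^esub> w \<otimes>\<^bsub>L\<^esub> (u \<otimes>\<^bsub>L\<^esub> v) = \<zero>\<^bsub>L\<^esub>"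

definition span_in :: "('k, 'm) ring_scheme \<Rightarrow> ('k, 'v) module \<Rightarrow> 'v set \<Rightarrow> 'v set" where
  "span_in K L S = (\<lambda>H. submodule H K L) hull S"

definition bracket_span ::
    "('k, 'm) ring_scheme \<Rightarrow> ('k, 'v) module \<Rightarrow> 'v set \<Rightarrow> 'v set \<Rightarrow> 'v set" where
  "bracket_span K L U V = span_in K L {u \<otimes>\<^bsub>L\<^esub> v | u v. u \<in> U \<and> v \<in> V}"

text \<open>The indexing is the one with $\Gamma_1(L) = [L,L]$; index 0 gives all of L.\<close>

primrec lower_central :: "('k, 'm) ring_scheme \<Rightarrow> ('k, 'v) module \<Rightarrow> nat \<Rightarrow> 'v set" where
  "lower_central K L 0 = carrier L"
| "lower_central K L (Suc k) = bracket_span K L (carrier L) (lower_central K L k)"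

definition lie_quot :: "('k, 'v) module \<Rightarrow> 'v set \<Rightarrow> ('k, 'v set) module" where
  "lie_quot L I =
    \<lparr>carrier = a_rcosets\<^bsub>L\<^esub> I, mult = rcoset_mult L I, one = undefined,
     zero = I, add = set_add L, smult = (\<lambda>a A. \<Union>v\<in>A. I +>\<^bsub>L\<^esub> (a \<odot>\<^bsub>L\<^esub> v))\<rparr>"


section \<open>Lie algebras given by generators and relations\<close>

datatype ('k, 'g) lie_term =
    Gen 'g
  | Zero
  | Add "('k, 'g) lie_term" "('k, 'g) lie_term"
  | Scale 'k "('k, 'g) lie_term"
  | Bracket "('k, 'g) lie_term" "('k, 'g) lie_term"

inductive_set lie_terms :: "('k, 'm) ring_scheme \<Rightarrow> 'g set \<Rightarrow> ('k, 'g) lie_term set"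
  for K :: "('k, 'm) ring_scheme" and G :: "'g set" where
  Gen: "g \<in> G \<Longrightarrow> Gen g \<in> lie_terms K G"
| Zero: "Zero \<in> lie_terms K G"
| Add: "\<lbrakk>s \<in> lie_terms K G; t \<in> lie_terms K G\<rbrakk> \<Longrightarrow> Add s t \<in> lie_terms K G"
| Scale: "\<lbrakk>a \<in> carrier K; t \<in> lie_terms K G\<rbrakk> \<Longrightarrow> Scale a t \<in> lie_terms K G"
| Bracket: "\<lbrakk>s \<in> lie_terms K G; t \<in> lie_terms K G\<rbrakk> \<Longrightarrow> Bracket s t \<in> lie_terms K G"

text \<open>
  The least congruence on terms over the generators G that contains the relations R
  and the axioms of a Lie algebra over K.
\<close>

inductive_set lie_rel ::
    "('k, 'm) ring_scheme \<Rightarrow> 'g set \<Rightarrow> (('k, 'g) lie_term \<times> ('k, 'g) lie_term) set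
      \<Rightarrow> (('k, 'g) lie_term \<times> ('k, 'g) lie_term) set"
  for K :: "('k, 'm) ring_scheme" and G :: "'g set"
    and R :: "(('k, 'g) lie_term \<times> ('k, 'g) lie_term) set" where
  relation: "\<lbrakk>(s, t) \<in> R; s \<in> lie_terms K G; t \<in> lie_terms K G\<rbrakk> \<Longrightarrow> (s, t) \<in> lie_rel K G R"
| refl: "t \<in> lie_terms K G \<Longrightarrow> (t, t) \<in> lie_rel K G R"
| sym: "(s, t) \<in> lie_rel K G R \<Longrightarrow> (t, s) \<in> lie_rel K G R"
| trans: "\<lbrakk>(s, t) \<in> lie_rel K G R; (t, u) \<in> lie_rel K G R\<rbrakk> \<Longrightarrow> (s, u) \<in> lie_rel K G R"
| cong_add: "\<lbrakk>(s, s') \<in> lie_rel K G R; (t, t') \<in> lie_rel K G R\<rbrakk>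
    \<Longrightarrow> (Add s t, Add s' t') \<in> lie_rel K G R"
| cong_scale: "\<lbrakk>a \<in> carrier K; (t, t') \<in> lie_rel K G R\<rbrakk>
    \<Longrightarrow> (Scale a t, Scale a t') \<in> lie_rel K G R"
| cong_bracket: "\<lbrakk>(s, s') \<in> lie_rel K G R; (t, t') \<in> lie_rel K G R\<rbrakk>
    \<Longrightarrow> (Bracket s t, Bracket s' t') \<in> lie_rel K G R"
| add_assoc: "\<lbrakk>s \<in> lie_terms K G; t \<in> lie_terms K G; u \<in> lie_terms K G\<rbrakk>
    \<Longrightarrow> (Add (Add s t) u, Add s (Add t u)) \<in> lie_rel K G R"
| add_comm: "\<lbrakk>s \<in> lie_terms K G; t \<in> lie_terms K G\<rbrakk>
    \<Longrightarrow> (Add s t, Add t s) \<in> lie_rel K G R"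
| add_zero: "t \<in> lie_terms K G \<Longrightarrow> (Add Zero t, t) \<in> lie_rel K G R"
| zero_scale: "t \<in> lie_terms K G \<Longrightarrow> (Scale \<zero>\<^bsub>K\<^esub> t, Zero) \<in> lie_rel K G R"
| one_scale: "t \<in> lie_terms K G \<Longrightarrow> (Scale \<one>\<^bsub>K\<^esub> t, t) \<in> lie_rel K G R"
| mult_scale: "\<lbrakk>a \<in> carrier K; b \<in> carrier K; t \<in> lie_terms K G\<rbrakk>
    \<Longrightarrow> (Scale (a \<otimes>\<^bsub>K\<^esub> b) t, Scale a (Scale b t)) \<in> lie_rel K G R"
| scale_left_distrib: "\<lbrakk>a \<in> carrier K; b \<in> carrier K; t \<in> lie_terms K G\<rbrakk>
    \<Longrightarrow> (Scale (a \<oplus>\<^bsub>K\<^esub> b) t, Add (Scale a t) (Scale b t)) \<in> lie_rel K G R"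
| scale_right_distrib: "\<lbrakk>a \<in> carrier K; s \<in> lie_terms K G; t \<in> lie_terms K G\<rbrakk>
    \<Longrightarrow> (Scale a (Add s t), Add (Scale a s) (Scale a t)) \<in> lie_rel K G R"
| bracket_add_left: "\<lbrakk>s \<in> lie_terms K G; t \<in> lie_terms K G; u \<in> lie_terms K G\<rbrakk>
    \<Longrightarrow> (Bracket (Add s t) u, Add (Bracket s u) (Bracket t u)) \<in> lie_rel K G R"
| bracket_add_right: "\<lbrakk>s \<in> lie_terms K G; t \<in> lie_terms K G; u \<in> lie_terms K G\<rbrakk>
    \<Longrightarrow> (Bracket s (Add t u), Add (Bracket s t) (Bracket s u)) \<in> lie_rel K G R"
| bracket_scale_left: "\<lbrakk>a \<in> carrier K; s \<in> lie_terms K G; t \<in> lie_terms K G\<rbrakk>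
    \<Longrightarrow> (Bracket (Scale a s) t, Scale a (Bracket s t)) \<in> lie_rel K G R"
| bracket_scale_right: "\<lbrakk>a \<in> carrier K; s \<in> lie_terms K G; t \<in> lie_terms K G\<rbrakk>
    \<Longrightarrow> (Bracket s (Scale a t), Scale a (Bracket s t)) \<in> lie_rel K G R"
| bracket_self: "t \<in> lie_terms K G \<Longrightarrow> (Bracket t t, Zero) \<in> lie_rel K G R"
| jacobi: "\<lbrakk>s \<in> lie_terms K G; t \<in> lie_terms K G; u \<in> lie_terms K G\<rbrakk>
    \<Longrightarrow> (Add (Add (Bracket s (Bracket t u)) (Bracket t (Bracket u s)))
          (Bracket u (Bracket s t)), Zero) \<in> lie_rel K G R"

definition lie_class ::
    "('k, 'm) ring_scheme \<Rightarrow> 'g set \<Rightarrow> (('k, 'g) lie_term \<times> ('k, 'g) lie_term) set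
      \<Rightarrow> ('k, 'g) lie_term \<Rightarrow> ('k, 'g) lie_term set" where
  "lie_class K G R t = lie_rel K G R `` {t}"

definition presented_lie ::
    "('k, 'm) ring_scheme \<Rightarrow> 'g set \<Rightarrow> (('k, 'g) lie_term \<times> ('k, 'g) lie_term) set
      \<Rightarrow> ('k, ('k, 'g) lie_term set) module" where
  "presented_lie K G R =
    \<lparr>carrier = lie_terms K G // lie_rel K G R,
     mult = (\<lambda>A B. \<Union>s\<in>A. \<Union>t\<in>B. lie_class K G R (Bracket s t)),
     one = undefined,
     zero = lie_class K G R Zero,
     add = (\<lambda>A B. \<Union>s\<in>A. \<Union>t\<in>B. lie_class K G R (Add s t)),
     smult = (\<lambda>a A. \<Union>t\<in>A. lie_class K G R (Scale a t))\<rparr>"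

primrec lie_eval :: "('k, 'v) module \<Rightarrow> ('g \<Rightarrow> 'v) \<Rightarrow> ('k, 'g) lie_term \<Rightarrow> 'v" where
  "lie_eval L f (Gen g) = f g"
| "lie_eval L f Zero = \<zero>\<^bsub>L\<^esub>"
| "lie_eval L f (Add s t) = lie_eval L f s \<oplus>\<^bsub>L\<^esub> lie_eval L f t"
| "lie_eval L f (Scale a t) = a \<odot>\<^bsub>L\<^esub> lie_eval L f t"
| "lie_eval L f (Bracket s t) = lie_eval L f s \<otimes>\<^bsub>L\<^esub> lie_eval L f t"

text \<open>
  The Lie algebra morphism from a presented Lie algebra to L that sends the class of each
  generator g to \<open>f g\<close>. It is meaningful when f respects the relations: then all
  representatives of a class have the same value (lemma \<open>lie_lift_class\<close> below).
\<close>

definition lie_lift ::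
    "('k, 'v) module \<Rightarrow> ('g \<Rightarrow> 'v) \<Rightarrow> ('k, 'g) lie_term set \<Rightarrow> 'v" where
  "lie_lift L f A = the_elem (lie_eval L f ` A)"


section \<open>The free Lie algebra on two generators\<close>

datatype letter = letter_x | letter_y

definition free_lie :: "('k, 'm) ring_scheme \<Rightarrow> ('k, ('k, letter) lie_term set) module" where
  "free_lie K = presented_lie K UNIV {}"

inductive homogeneous ::
    "('k, 'm) ring_scheme \<Rightarrow> nat \<Rightarrow> ('k, letter) lie_term set \<Rightarrow> bool"
  for K :: "('k, 'm) ring_scheme" where
  gen: "homogeneous K 1 (lie_class K UNIV {} (Gen g))"
| zero: "homogeneous K d \<zero>\<^bsub>free_lie K\<^esub>"
| add: "\<lbrakk>homogeneous K d u; homogeneous K d v\<rbrakk> \<Longrightarrow> homogeneous K d (u \<oplus>\<^bsub>free_lie K\<^esub> v)"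
| smult: "\<lbrakk>a \<in> carrier K; homogeneous K d v\<rbrakk> \<Longrightarrow> homogeneous K d (a \<odot>\<^bsub>free_lie K\<^esub> v)"
| bracket: "\<lbrakk>homogeneous K d u; homogeneous K e v\<rbrakk>
    \<Longrightarrow> homogeneous K (d + e) (u \<otimes>\<^bsub>free_lie K\<^esub> v)"

definition free_lie_ge ::
    "('k, 'm) ring_scheme \<Rightarrow> nat \<Rightarrow> ('k, letter) lie_term set set" where
  "free_lie_ge K n = span_in K (free_lie K) {v. \<exists>d\<ge>n. homogeneous K d v}"

text \<open>$\varphi(u,v)$ for $\varphi \in \mathbb{L}(x,y)$ and u, v in a Lie algebra L.\<close>

definition lie_subst ::
    "('k, 'v) module \<Rightarrow> ('k, letter) lie_term set \<Rightarrow> 'v \<Rightarrow> 'v \<Rightarrow> 'v" where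
  "lie_subst L \<phi> u v = lie_lift L (case_letter u v) \<phi>"


section \<open>The Drinfeld--Kohno Lie algebras\<close>

definition dk_gens :: "nat \<Rightarrow> (nat \<times> nat) set" where
  "dk_gens n = {1..n} \<times> {1..n}"

definition dk_rels ::
    "nat \<Rightarrow> (('k, nat \<times> nat) lie_term \<times> ('k, nat \<times> nat) lie_term) set" where
  "dk_rels n =
    {(Gen (i, j), Gen (j, i)) | i j. i \<in> {1..n} \<and> j \<in> {1..n}} \<union>
    {(Gen (i, i), Zero) | i. i \<in> {1..n}} \<union>
    {(Bracket (Gen (i, j)) (Gen (k, l)), Zero) | i j k l.
      {i, j, k, l} \<subseteq> {1..n} \<and> distinct [i, j, k, l]} \<union>
    {(Bracket (Gen (i, j)) (Add (Gen (i, k)) (Gen (j, k))), Zero) | i j k.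
      {i, j, k} \<subseteq> {1..n} \<and> distinct [i, j, k]}"

type_synonym 'k dk_elem = "('k, nat \<times> nat) lie_term set"

definition dk :: "('k, 'm) ring_scheme \<Rightarrow> nat \<Rightarrow> ('k, 'k dk_elem) module" where
  "dk K n = presented_lie K (dk_gens n) (dk_rels n)"

definition dk_t :: "('k, 'm) ring_scheme \<Rightarrow> nat \<Rightarrow> nat \<Rightarrow> nat \<Rightarrow> 'k dk_elem" where
  "dk_t K n i j = lie_class K (dk_gens n) (dk_rels n) (Gen (i, j))"

text \<open>
  The increasing relabelling of $\{1,\dots,n\} \setminus \{i\}$ by $\{1,\dots,n-1\}$
  lowers the indices above i by one.
\<close>

definition relabel :: "nat \<Rightarrow> nat \<Rightarrow> nat" where
  "relabel i k = (if i < k then k - 1 else k)"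

definition pr :: "('k, 'm) ring_scheme \<Rightarrow> nat \<Rightarrow> nat \<Rightarrow> 'k dk_elem \<Rightarrow> 'k dk_elem" where
  "pr K n i = lie_lift (dk K (n - 1))
    (\<lambda>(k, l). if k = i \<or> l = i then \<zero>\<^bsub>dk K (n - 1)\<^esub>
              else dk_t K (n - 1) (relabel i k) (relabel i l))"

text \<open>The Lie subalgebra of $\mathfrak{t}_4$ cut out by the projections with index in I.\<close>

definition brun :: "('k, 'm) ring_scheme \<Rightarrow> nat set \<Rightarrow> ('k, 'k dk_elem) module" where
  "brun K I = (dk K 4)\<lparr>carrier := (\<Inter>i\<in>I. a_kernel (dk K 4) (dk K 3) (pr K 4 i))\<rparr>"

definition brun4 :: "('k, 'm) ring_scheme \<Rightarrow> ('k, 'k dk_elem) module" where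
  "brun4 K = brun K {1, 2, 3, 4}"

definition brun13 :: "('k, 'm) ring_scheme \<Rightarrow> ('k, 'k dk_elem) module" where
  "brun13 K = brun K {2, 3, 4}"

definition brun22 :: "('k, 'm) ring_scheme \<Rightarrow> ('k, 'k dk_elem) module" where
  "brun22 K = brun K {3, 4}"


section \<open>The pentagon equation\<close>

definition pent :: "('k, 'm) ring_scheme \<Rightarrow> ('k, letter) lie_term set \<Rightarrow> 'k dk_elem" where
  "pent K \<phi> =
    (let L = dk K 4; t = dk_t K 4 in
      lie_subst L \<phi> (t 1 2) (t 2 3)
      \<oplus>\<^bsub>L\<^esub> lie_subst L \<phi> (t 1 2 \<oplus>\<^bsub>L\<^esub> t 1 3) (t 2 4 \<oplus>\<^bsub>L\<^esub> t 3 4)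
      \<oplus>\<^bsub>L\<^esub> lie_subst L \<phi> (t 2 3) (t 3 4)
      \<ominus>\<^bsub>L\<^esub> lie_subst L \<phi> (t 1 3 \<oplus>\<^bsub>L\<^esub> t 2 3) (t 3 4)
      \<ominus>\<^bsub>L\<^esub> lie_subst L \<phi> (t 1 2) (t 2 3 \<oplus>\<^bsub>L\<^esub> t 2 4))"

definition central_quot ::
    "('k, 'm) ring_scheme \<Rightarrow> ('k, 'v) module \<Rightarrow> nat \<Rightarrow> ('k, 'v set) module" where
  "central_quot K L k = lie_quot L (lower_central K L k)"

definition central_class ::
    "('k, 'm) ring_scheme \<Rightarrow> ('k, 'v) module \<Rightarrow> nat \<Rightarrow> 'v \<Rightarrow> 'v set" where
  "central_class K L k v = lower_central K L k +>\<^bsub>L\<^esub> v"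

definition pent_k ::
    "('k, 'm) ring_scheme \<Rightarrow> nat \<Rightarrow> ('k, letter) lie_term set \<Rightarrow> 'k dk_elem set" where
  "pent_k K k \<phi> = central_class K (brun4 K) k (pent K \<phi>)"

definition pent_dmr ::
    "('k, 'm) ring_scheme \<Rightarrow> nat \<Rightarrow> ('k, letter) lie_term set \<Rightarrow> 'k dk_elem set" where
  "pent_dmr K k \<phi> = central_class K (brun13 K) k (pent K \<phi>)"

definition pent_krv ::
    "('k, 'm) ring_scheme \<Rightarrow> nat \<Rightarrow> ('k, letter) lie_term set \<Rightarrow> 'k dk_elem set" where
  "pent_krv K k \<phi> = central_class K (brun22 K) k (pent K \<phi>)"


section \<open>Well-definedness\<close>

lemma lie_rel_terms:
  assumes "cring K" "(s, t) \<in> lie_rel K G R"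
  shows "s \<in> lie_terms K G \<and> t \<in> lie_terms K G"
proof -
  interpret cring K by fact
  show ?thesis using assms(2)
    by (induction) (auto intro: lie_terms.intros)
qed

lemma equiv_lie_rel:
  assumes "cring K"
  shows "equiv (lie_terms K G) (lie_rel K G R)"
proof (rule equivI)
  show "lie_rel K G R \<subseteq> lie_terms K G \<times> lie_terms K G"
    using lie_rel_terms[OF assms] by auto
  show "refl_on (lie_terms K G) (lie_rel K G R)"
    by (auto simp: refl_on_def intro: lie_rel.refl)
  show "sym (lie_rel K G R)" by (auto simp: sym_def intro: lie_rel.sym)
  show "trans (lie_rel K G R)" by (auto simp: trans_def intro: lie_rel.trans)
qed

lemma lie_class_eqI: 
  assumes "cring K" "(s, t) \<in> lie_rel K G R"
  shows "lie_class K G R s = lie_class K G R t"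
  unfolding lie_class_def using equiv_class_eq[OF equiv_lie_rel[OF assms(1)] assms(2)] .

lemma presented_lie_zero: "\<zero>\<^bsub>presented_lie K G R\<^esub> = lie_class K G R Zero"
  by (simp add: presented_lie_def)

lemma presented_lie_ops:
  assumes "cring K" "s \<in> lie_terms K G" "t \<in> lie_terms K G"
  shows "lie_class K G R s \<oplus>\<^bsub>presented_lie K G R\<^esub> lie_class K G R t = lie_class K G R (Add s t)"
    and "lie_class K G R s \<otimes>\<^bsub>presented_lie K G R\<^esub> lie_class K G R t = lie_class K G R (Bracket s t)"
    and "a \<in> carrier K \<Longrightarrow> a \<odot>\<^bsub>presented_lie K G R\<^esub> lie_class K G R t = lie_class K G R (Scale a t)"
proof -
  note eq = equiv_lie_rel[OF assms(1)]
  note ceq = lie_class_eqI[OF assms(1)]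
  have "congruent2 (lie_rel K G R) (lie_rel K G R) (\<lambda>s t. lie_class K G R (Add s t))"
    by (auto intro!: congruent2I' ceq lie_rel.cong_add)
  from UN_equiv_class2[OF eq eq this assms(2,3)]
  show "lie_class K G R s \<oplus>\<^bsub>presented_lie K G R\<^esub> lie_class K G R t = lie_class K G R (Add s t)"
    by (simp add: presented_lie_def lie_class_def)
  have "congruent2 (lie_rel K G R) (lie_rel K G R) (\<lambda>s t. lie_class K G R (Bracket s t))"
    by (auto intro!: congruent2I' ceq lie_rel.cong_bracket)
  from UN_equiv_class2[OF eq eq this assms(2,3)]
  show "lie_class K G R s \<otimes>\<^bsub>presented_lie K G R\<^esub> lie_class K G R t = lie_class K G R (Bracket s t)"
    by (simp add: presented_lie_def lie_class_def)
  show "a \<odot>\<^bsub>presented_lie K G R\<^esub> lie_class K G R t = lie_class K G R (Scale a t)" if "a \<in> carrier K"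
  proof -
    have "congruent (lie_rel K G R) (\<lambda>t. lie_class K G R (Scale a t))"
      using that by (auto intro!: congruentI ceq lie_rel.cong_scale)
    from UN_equiv_class[OF eq this assms(3)]
    show ?thesis by (simp add: presented_lie_def lie_class_def)
  qed
qed

lemma carrier_presented_lie:
  "carrier (presented_lie K G R) = lie_class K G R ` lie_terms K G"
  by (auto simp: presented_lie_def quotient_def lie_class_def)

lemma lie_algebra_presented_lie:
  assumes "cring K"
  shows "lie_algebra K (presented_lie K G R)"
proof -
  interpret K: cring K by fact
  note ops = presented_lie_ops[OF assms] presented_lie_zero
  note ceq = lie_class_eqI[OF assms]
  note eqs = lie_rel.intros(8,10-)[THEN ceq]
  let ?P = "presented_lie K G R"
  have ag: "abelian_group ?P"
  proof (rule abelian_groupI)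
    fix A assume "A \<in> carrier ?P"
    then obtain t where t: "t \<in> lie_terms K G" "A = lie_class K G R t"
      by (auto simp: carrier_presented_lie)
    let ?n = "Scale (\<ominus>\<^bsub>K\<^esub> \<one>\<^bsub>K\<^esub>) t"
    have n: "?n \<in> lie_terms K G" using t by (auto intro: lie_terms.intros)
    have "(Add ?n t, Add ?n (Scale \<one>\<^bsub>K\<^esub> t)) \<in> lie_rel K G R"
      using t n by (intro lie_rel.cong_add lie_rel.refl lie_rel.sym[OF lie_rel.one_scale])
    moreover have "(Add ?n (Scale \<one>\<^bsub>K\<^esub> t), Scale (\<ominus>\<^bsub>K\<^esub> \<one>\<^bsub>K\<^esub> \<oplus>\<^bsub>K\<^esub> \<one>\<^bsub>K\<^esub>) t) \<in> lie_rel K G R"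
      using t by (intro lie_rel.sym[OF lie_rel.scale_left_distrib]) auto
    moreover have "(Scale (\<ominus>\<^bsub>K\<^esub> \<one>\<^bsub>K\<^esub> \<oplus>\<^bsub>K\<^esub> \<one>\<^bsub>K\<^esub>) t, Zero) \<in> lie_rel K G R"
      using t lie_rel.zero_scale by (simp add: K.l_neg)
    ultimately have "(Add ?n t, Zero) \<in> lie_rel K G R" by (blast intro: lie_rel.trans)
    then show "\<exists>B\<in>carrier ?P. B \<oplus>\<^bsub>?P\<^esub> A = \<zero>\<^bsub>?P\<^esub>"
      using t n by (auto simp: carrier_presented_lie ops intro!: ceq bexI[of _ ?n])
  next
    fix A B assume "A \<in> carrier ?P" "B \<in> carrier ?P"
    then show "A \<oplus>\<^bsub>?P\<^esub> B = B \<oplus>\<^bsub>?P\<^esub> A"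
      unfolding carrier_presented_lie image_iff by (metis ops(1) ceq lie_rel.add_comm)
  qed (auto simp: carrier_presented_lie ops lie_terms.intros eqs intro!: imageI lie_terms.intros)
  have "module K ?P"
    by (rule moduleI[OF assms ag])
      (auto simp: carrier_presented_lie ops lie_terms.intros eqs intro!: imageI lie_terms.intros)
  then show ?thesis
    by (intro lie_algebra.intro lie_algebra_axioms.intro)
      (auto simp: carrier_presented_lie ops lie_terms.intros lie_rel.intros(10-)[THEN ceq] intro!: imageI lie_terms.intros)
qed

context lie_algebra
begin

lemmas lie_jacobi = jacobi

lemma lie_eval_closed:
  assumes "\<And>g. g \<in> G \<Longrightarrow> f g \<in> carrier L" "t \<in> lie_terms K G"
  shows "lie_eval L f t \<in> carrier L"
  using assms(2) by induction (auto simp: assms(1) bracket_closed)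

lemma lie_eval_cong:
  assumes f: "\<And>g. g \<in> G \<Longrightarrow> f g \<in> carrier L"
    and R: "\<And>s t. (s, t) \<in> R \<Longrightarrow> lie_eval L f s = lie_eval L f t"
    and st: "(s, t) \<in> lie_rel K G R"
  shows "lie_eval L f s = lie_eval L f t"
  using st
proof induction
  case (jacobi s t u)
  then show ?case by (simp add: lie_eval_closed[OF f] lie_jacobi)
qed (auto simp: R lie_eval_closed[OF f] bracket_closed M.a_assoc M.a_comm M.a_lcomm smult_assoc1
        smult_l_distr smult_r_distr bracket_add_left bracket_add_right bracket_smult_left
        bracket_smult_right bracket_self)

lemma lie_lift_class_aux:
  assumes "\<And>g. g \<in> G \<Longrightarrow> f g \<in> carrier L"
    and "\<And>s t. (s, t) \<in> R \<Longrightarrow> lie_eval L f s = lie_eval L f t"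
    and t: "t \<in> lie_terms K G"
  shows "lie_lift L f (lie_class K G R t) = lie_eval L f t"
proof -
  have "lie_eval L f ` lie_class K G R t = {lie_eval L f t}"
    using lie_eval_cong[OF assms(1,2)] lie_rel.refl[OF t]
    by (fastforce simp: lie_class_def)
  then show ?thesis by (simp add: lie_lift_def)
qed


lemma bracket_zero:
  assumes "u \<in> carrier L"
  shows "\<zero>\<^bsub>L\<^esub> \<otimes>\<^bsub>L\<^esub> u = \<zero>\<^bsub>L\<^esub>" "u \<otimes>\<^bsub>L\<^esub> \<zero>\<^bsub>L\<^esub> = \<zero>\<^bsub>L\<^esub>"
  using assms bracket_smult_left[of "\<zero>\<^bsub>K\<^esub>" "\<zero>\<^bsub>L\<^esub>" u] bracket_smult_right[of "\<zero>\<^bsub>K\<^esub>" u "\<zero>\<^bsub>L\<^esub>"]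
  by (simp_all add: bracket_closed)

lemma lie_lift_hom_aux:
  assumes f: "\<And>g. g \<in> G \<Longrightarrow> f g \<in> carrier L"
    and R: "\<And>s t. (s, t) \<in> R \<Longrightarrow> lie_eval L f s = lie_eval L f t"
  defines "P \<equiv> presented_lie K G R"
  shows "lie_lift L f \<zero>\<^bsub>P\<^esub> = \<zero>\<^bsub>L\<^esub>"
    and "A \<in> carrier P \<Longrightarrow> lie_lift L f A \<in> carrier L"
    and "A \<in> carrier P \<Longrightarrow> B \<in> carrier P \<Longrightarrow>
      lie_lift L f (A \<oplus>\<^bsub>P\<^esub> B) = lie_lift L f A \<oplus>\<^bsub>L\<^esub> lie_lift L f B"
    and "A \<in> carrier P \<Longrightarrow> B \<in> carrier P \<Longrightarrow>
      lie_lift L f (A \<otimes>\<^bsub>P\<^esub> B) = lie_lift L f A \<otimes>\<^bsub>L\<^esub> lie_lift L f B"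
    and "a \<in> carrier K \<Longrightarrow> A \<in> carrier P \<Longrightarrow>
      lie_lift L f (a \<odot>\<^bsub>P\<^esub> A) = a \<odot>\<^bsub>L\<^esub> lie_lift L f A"
proof -
  note cl = lie_lift_class_aux[of G f R, OF f R]
  note simps = carrier_presented_lie presented_lie_ops[OF R.is_cring] presented_lie_zero cl lie_terms.intros
    lie_eval_closed[OF f]
  show "lie_lift L f \<zero>\<^bsub>P\<^esub> = \<zero>\<^bsub>L\<^esub>" by (simp add: P_def simps)
  show "A \<in> carrier P \<Longrightarrow> lie_lift L f A \<in> carrier L"
    and "A \<in> carrier P \<Longrightarrow> B \<in> carrier P \<Longrightarrow>
      lie_lift L f (A \<oplus>\<^bsub>P\<^esub> B) = lie_lift L f A \<oplus>\<^bsub>L\<^esub> lie_lift L f B"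
    and "A \<in> carrier P \<Longrightarrow> B \<in> carrier P \<Longrightarrow>
      lie_lift L f (A \<otimes>\<^bsub>P\<^esub> B) = lie_lift L f A \<otimes>\<^bsub>L\<^esub> lie_lift L f B"
    and "a \<in> carrier K \<Longrightarrow> A \<in> carrier P \<Longrightarrow>
      lie_lift L f (a \<odot>\<^bsub>P\<^esub> A) = a \<odot>\<^bsub>L\<^esub> lie_lift L f A"
    by (auto simp: P_def simps)
qed

lemma
  assumes f: "f \<in> G \<rightarrow> carrier L" and R: "\<forall>(s, t)\<in>R. lie_eval L f s = lie_eval L f t"
  shows lie_lift_class: "t \<in> lie_terms K G \<Longrightarrow> lie_lift L f (lie_class K G R t) = lie_eval L f t"
    and lie_lift_zero: "lie_lift L f \<zero>\<^bsub>presented_lie K G R\<^esub> = \<zero>\<^bsub>L\<^esub>"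
    and lie_lift_closed: "A \<in> carrier (presented_lie K G R) \<Longrightarrow> lie_lift L f A \<in> carrier L"
    and lie_lift_add: "A \<in> carrier (presented_lie K G R) \<Longrightarrow> B \<in> carrier (presented_lie K G R) \<Longrightarrow>
      lie_lift L f (A \<oplus>\<^bsub>presented_lie K G R\<^esub> B) = lie_lift L f A \<oplus>\<^bsub>L\<^esub> lie_lift L f B"
    and lie_lift_bracket: "A \<in> carrier (presented_lie K G R) \<Longrightarrow> B \<in> carrier (presented_lie K G R) \<Longrightarrow>
      lie_lift L f (A \<otimes>\<^bsub>presented_lie K G R\<^esub> B) = lie_lift L f A \<otimes>\<^bsub>L\<^esub> lie_lift L f B"
    and lie_lift_smult: "a \<in> carrier K \<Longrightarrow> A \<in> carrier (presented_lie K G R) \<Longrightarrow>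
      lie_lift L f (a \<odot>\<^bsub>presented_lie K G R\<^esub> A) = a \<odot>\<^bsub>L\<^esub> lie_lift L f A"
proof -
  have f: "\<And>g. g \<in> G \<Longrightarrow> f g \<in> carrier L" and R: "\<And>s t. (s, t) \<in> R \<Longrightarrow> lie_eval L f s = lie_eval L f t"
    using assms by auto
  show "t \<in> lie_terms K G \<Longrightarrow> lie_lift L f (lie_class K G R t) = lie_eval L f t"
    by (rule lie_lift_class_aux[OF f R])
  show "lie_lift L f \<zero>\<^bsub>presented_lie K G R\<^esub> = \<zero>\<^bsub>L\<^esub>"
    by (rule lie_lift_hom_aux[OF f R])
  show "A \<in> carrier (presented_lie K G R) \<Longrightarrow> lie_lift L f A \<in> carrier L"
    by (rule lie_lift_hom_aux[OF f R])
  show "A \<in> carrier (presented_lie K G R) \<Longrightarrow> B \<in> carrier (presented_lie K G R) \<Longrightarrow>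
      lie_lift L f (A \<oplus>\<^bsub>presented_lie K G R\<^esub> B) = lie_lift L f A \<oplus>\<^bsub>L\<^esub> lie_lift L f B"
    by (rule lie_lift_hom_aux[OF f R])
  show "A \<in> carrier (presented_lie K G R) \<Longrightarrow> B \<in> carrier (presented_lie K G R) \<Longrightarrow>
      lie_lift L f (A \<otimes>\<^bsub>presented_lie K G R\<^esub> B) = lie_lift L f A \<otimes>\<^bsub>L\<^esub> lie_lift L f B"
    by (rule lie_lift_hom_aux[OF f R])
  show "a \<in> carrier K \<Longrightarrow> A \<in> carrier (presented_lie K G R) \<Longrightarrow>
      lie_lift L f (a \<odot>\<^bsub>presented_lie K G R\<^esub> A) = a \<odot>\<^bsub>L\<^esub> lie_lift L f A"
    by (rule lie_lift_hom_aux[OF f R])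
qed

lemmas lie_lift_hom = lie_lift_zero lie_lift_closed lie_lift_add lie_lift_bracket lie_lift_smult

lemma homogeneous_closed: "homogeneous K d A \<Longrightarrow> A \<in> carrier (free_lie K)"
proof -
  interpret F: lie_algebra K "free_lie K"
    unfolding free_lie_def by (rule lie_algebra_presented_lie[OF R.is_cring])
  show "homogeneous K d A \<Longrightarrow> A \<in> carrier (free_lie K)"
  proof (induction rule: homogeneous.induct)
    case (gen x)
    show ?case by (auto simp: free_lie_def carrier_presented_lie intro: lie_terms.intros)
  qed (auto simp: F.bracket_closed)
qed

lemma lie_subst_closed:
  assumes "u \<in> carrier L" "v \<in> carrier L" "\<phi> \<in> carrier (free_lie K)"
  shows "lie_subst L \<phi> u v \<in> carrier L"
  using assms lie_lift_hom_aux(2)[of UNIV "case_letter u v" "{}" \<phi>]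
  by (auto simp: lie_subst_def free_lie_def split: letter.split)

lemma free_lie_ge_closed: "free_lie_ge K n \<subseteq> carrier (free_lie K)"
proof -
  interpret F: lie_algebra K "free_lie K"
    unfolding free_lie_def by (rule lie_algebra_presented_lie[OF R.is_cring])
  show ?thesis unfolding free_lie_ge_def span_in_def
    by (rule hull_minimal) (auto intro: homogeneous_closed F.carrier_is_submodule)
qed

lemma lie_subst_vanish:
  assumes uv: "u \<in> carrier L" "v \<in> carrier L" "u = \<zero>\<^bsub>L\<^esub> \<or> v = \<zero>\<^bsub>L\<^esub>"
    and \<phi>: "\<phi> \<in> free_lie_ge K 2"
  shows "lie_subst L \<phi> u v = \<zero>\<^bsub>L\<^esub>"
proof -
  interpret F: lie_algebra K "free_lie K"
    unfolding free_lie_def by (rule lie_algebra_presented_lie[OF R.is_cring])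
  define f where "f = case_letter u v"
  have f: "f \<in> UNIV \<rightarrow> carrier L" using uv by (simp add: f_def split: letter.split)
  have E: "\<forall>(s, t)\<in>{}. lie_eval L f s = lie_eval L f t" by simp
  note hom = lie_lift_hom[OF f E, folded free_lie_def]
  define w where "w = (if u = \<zero>\<^bsub>L\<^esub> then v else u)"
  have w: "w \<in> carrier L" using uv by (simp add: w_def)
  have *: "(\<exists>c\<in>carrier K. lie_lift L f A = c \<odot>\<^bsub>L\<^esub> w) \<and> (d \<noteq> 1 \<longrightarrow> lie_lift L f A = \<zero>\<^bsub>L\<^esub>)"
    if "homogeneous K d A" for d A
    using that
  proof induction
    case (gen x)
    have "lie_lift L f (lie_class K UNIV {} (Gen x)) = f x"
      using lie_lift_class[OF f E, of "Gen x"] lie_terms.intros(1)[of x UNIV K] by simp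
    moreover have "f x = \<zero>\<^bsub>K\<^esub> \<odot>\<^bsub>L\<^esub> w \<or> f x = \<one>\<^bsub>K\<^esub> \<odot>\<^bsub>L\<^esub> w"
      using uv w by (auto simp: w_def f_def split: letter.split)
    ultimately show ?case by auto
  next
    case (zero d)
    have "lie_lift L f \<zero>\<^bsub>free_lie K\<^esub> = \<zero>\<^bsub>L\<^esub>" by (rule hom(1))
    then show ?case using w by (auto intro!: bexI[of _ "\<zero>\<^bsub>K\<^esub>"])
  next
    case (add d A B)
    then obtain a b where ab: "a \<in> carrier K" "b \<in> carrier K"
      "lie_lift L f A = a \<odot>\<^bsub>L\<^esub> w" "lie_lift L f B = b \<odot>\<^bsub>L\<^esub> w" by blast
    have "lie_lift L f (A \<oplus>\<^bsub>free_lie K\<^esub> B) = lie_lift L f A \<oplus>\<^bsub>L\<^esub> lie_lift L f B"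
      using add by (intro hom homogeneous_closed)
    then show ?case using add.IH ab w
      by (metis R.add.m_closed smult_l_distr M.l_zero M.zero_closed)
  next
    case (smult a d A)
    then obtain b where ab: "b \<in> carrier K" "lie_lift L f A = b \<odot>\<^bsub>L\<^esub> w" by blast
    have "lie_lift L f (a \<odot>\<^bsub>free_lie K\<^esub> A) = a \<odot>\<^bsub>L\<^esub> lie_lift L f A"
      using smult by (intro hom homogeneous_closed)
    then show ?case using smult ab w
      by (metis R.m_closed smult_assoc1 smult_r_null)
  next
    case (bracket d A e B)
    then obtain a b where ab: "a \<in> carrier K" "b \<in> carrier K"
      "lie_lift L f A = a \<odot>\<^bsub>L\<^esub> w" "lie_lift L f B = b \<odot>\<^bsub>L\<^esub> w" by blast
    have "lie_lift L f (A \<otimes>\<^bsub>free_lie K\<^esub> B) = lie_lift L f A \<otimes>\<^bsub>L\<^esub> lie_lift L f B"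
      using bracket by (intro hom homogeneous_closed)
    also have "\<dots> = \<zero>\<^bsub>L\<^esub>"
      using ab w by (simp add: bracket_smult_left bracket_smult_right bracket_closed bracket_self)
    finally show ?case using w by (auto intro!: bexI[of _ "\<zero>\<^bsub>K\<^esub>"])
  qed
  define H where "H = {A \<in> carrier (free_lie K). lie_lift L f A = \<zero>\<^bsub>L\<^esub>}"
  have "submodule H K (free_lie K)"
  proof (rule F.submoduleI)
    fix A assume A: "A \<in> H"
    then have "lie_lift L f ((\<ominus>\<^bsub>K\<^esub> \<one>\<^bsub>K\<^esub>) \<odot>\<^bsub>free_lie K\<^esub> A) = (\<ominus>\<^bsub>K\<^esub> \<one>\<^bsub>K\<^esub>) \<odot>\<^bsub>L\<^esub> lie_lift L f A"
      by (intro hom) (auto simp: H_def)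
    then show "\<ominus>\<^bsub>free_lie K\<^esub> A \<in> H" using A by (simp add: H_def F.smult_l_minus)
  qed (auto simp: H_def hom)
  moreover have "{A. \<exists>d\<ge>2. homogeneous K d A} \<subseteq> H"
    using * homogeneous_closed by (fastforce simp: H_def)
  ultimately have "free_lie_ge K 2 \<subseteq> H"
    unfolding free_lie_ge_def span_in_def by (rule hull_minimal[rotated])
  then show ?thesis using \<phi> by (auto simp: H_def lie_subst_def f_def)
qed

lemma free_lie_ge_antimono: "m \<le> n \<Longrightarrow> free_lie_ge K n \<subseteq> free_lie_ge K m"
  unfolding free_lie_ge_def span_in_def by (rule hull_mono) (auto intro: order_trans)

end

lemma lie_algebra_dk: "cring K \<Longrightarrow> lie_algebra K (dk K n)"
  unfolding dk_def by (rule lie_algebra_presented_lie)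

lemma dk_t_closed: "i \<in> {1..n} \<Longrightarrow> j \<in> {1..n} \<Longrightarrow> dk_t K n i j \<in> carrier (dk K n)"
  by (auto simp: dk_t_def dk_def carrier_presented_lie dk_gens_def intro!: imageI lie_terms.intros)

lemma dk_relations:
  assumes K: "cring K"
  shows "\<lbrakk>i \<in> {1..n}; j \<in> {1..n}\<rbrakk> \<Longrightarrow> dk_t K n i j = dk_t K n j i"
    and "i \<in> {1..n} \<Longrightarrow> dk_t K n i i = \<zero>\<^bsub>dk K n\<^esub>"
    and "\<lbrakk>{i, j, k, l} \<subseteq> {1..n}; distinct [i, j, k, l]\<rbrakk>
      \<Longrightarrow> dk_t K n i j \<otimes>\<^bsub>dk K n\<^esub> dk_t K n k l = \<zero>\<^bsub>dk K n\<^esub>"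
    and "\<lbrakk>{i, j, k} \<subseteq> {1..n}; distinct [i, j, k]\<rbrakk>
      \<Longrightarrow> dk_t K n i j \<otimes>\<^bsub>dk K n\<^esub> (dk_t K n i k \<oplus>\<^bsub>dk K n\<^esub> dk_t K n j k) = \<zero>\<^bsub>dk K n\<^esub>"
proof -
  have g: "Gen (i, j) \<in> lie_terms K (dk_gens n)" if "i \<in> {1..n}" "j \<in> {1..n}" for i j
    using that by (auto simp: dk_gens_def intro: lie_terms.intros)
  note simps = dk_t_def dk_def presented_lie_ops[OF K] presented_lie_zero g lie_terms.intros
  note I = lie_class_eqI[OF K lie_rel.relation]
  show "dk_t K n i j = dk_t K n j i" if "i \<in> {1..n}" "j \<in> {1..n}"
    unfolding dk_t_def using that by (intro I g) (auto simp: dk_rels_def)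
  show "dk_t K n i i = \<zero>\<^bsub>dk K n\<^esub>" if "i \<in> {1..n}"
    unfolding dk_t_def dk_def presented_lie_zero
    using that by (intro I g lie_terms.intros) (auto simp: dk_rels_def)
  show "dk_t K n i j \<otimes>\<^bsub>dk K n\<^esub> dk_t K n k l = \<zero>\<^bsub>dk K n\<^esub>"
    if d: "{i, j, k, l} \<subseteq> {1..n}" "distinct [i, j, k, l]"
  proof -
    have "lie_class K (dk_gens n) (dk_rels n) (Bracket (Gen (i, j)) (Gen (k, l)))
      = lie_class K (dk_gens n) (dk_rels n) Zero"
      using d by (intro I g lie_terms.intros) (auto simp: dk_rels_def dk_gens_def)
    then show ?thesis using d by (simp add: simps)
  qed
  show "dk_t K n i j \<otimes>\<^bsub>dk K n\<^esub> (dk_t K n i k \<oplus>\<^bsub>dk K n\<^esub> dk_t K n j k) = \<zero>\<^bsub>dk K n\<^esub>"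
    if d: "{i, j, k} \<subseteq> {1..n}" "distinct [i, j, k]"
  proof -
    have "lie_class K (dk_gens n) (dk_rels n) (Bracket (Gen (i, j)) (Add (Gen (i, k)) (Gen (j, k))))
      = lie_class K (dk_gens n) (dk_rels n) Zero"
      using d by (intro I g lie_terms.intros) (auto simp: dk_rels_def dk_gens_def)
    then show ?thesis using d by (simp add: simps)
  qed
qed

lemma
  assumes K: "cring K" and i: "i \<in> {1..n}"
  defines "f \<equiv> (\<lambda>(k, l). if k = i \<or> l = i then \<zero>\<^bsub>dk K (n - 1)\<^esub>
              else dk_t K (n - 1) (relabel i k) (relabel i l))"
  shows pr_gens_closed: "g \<in> dk_gens n \<Longrightarrow> f g \<in> carrier (dk K (n - 1))"
    and pr_respects: "(s, t) \<in> dk_rels n \<Longrightarrow> lie_eval (dk K (n - 1)) f s = lie_eval (dk K (n - 1)) f t"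
proof -
  define m where "m = n - 1"
  interpret D: lie_algebra K "dk K m" by (rule lie_algebra_dk[OF K])
  have rl: "relabel i k \<in> {1..m}" if "k \<in> {1..n}" "k \<noteq> i" for k
    using i that by (auto simp: relabel_def m_def)
  have ri: "relabel i k = relabel i l \<longleftrightarrow> k = l" if "k \<noteq> i" "l \<noteq> i" for k l
    using that by (auto simp: relabel_def)
  have f_def: "f = (\<lambda>(k, l). if k = i \<or> l = i then \<zero>\<^bsub>dk K m\<^esub> else dk_t K m (relabel i k) (relabel i l))"
    unfolding f_def m_def ..
  have c: "f (k, l) \<in> carrier (dk K m)" if "k \<in> {1..n}" "l \<in> {1..n}" for k l
    using that rl dk_t_closed[of _ m _ K] by (auto simp: f_def simp del: atLeastAtMost_iff)
  then show "g \<in> dk_gens n \<Longrightarrow> f g \<in> carrier (dk K m)"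
    by (auto simp: dk_gens_def)
  assume "(s, t) \<in> dk_rels n"
  then consider
    (1) k l where "s = Gen (k, l)" "t = Gen (l, k)" "k \<in> {1..n}" "l \<in> {1..n}"
  | (2) k where "s = Gen (k, k)" "t = Zero" "k \<in> {1..n}"
  | (3) k l p q where "s = Bracket (Gen (k, l)) (Gen (p, q))" "t = Zero"
      "{k, l, p, q} \<subseteq> {1..n}" "distinct [k, l, p, q]"
  | (4) k l p where "s = Bracket (Gen (k, l)) (Add (Gen (k, p)) (Gen (l, p)))" "t = Zero"
      "{k, l, p} \<subseteq> {1..n}" "distinct [k, l, p]"
    unfolding dk_rels_def Un_iff
    by (elim disjE CollectE exE conjE Pair_inject) (assumption | rule that(1) that(2) that(3) that(4), assumption+)+
  then show "lie_eval (dk K m) f s = lie_eval (dk K m) f t"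
  proof cases
    case 1
    then show ?thesis using dk_relations(1)[OF K rl rl, of k l] by (simp add: f_def)
  next
    case 2
    then show ?thesis using dk_relations(2)[OF K rl, of k] by (simp add: f_def)
  next
    case 3
    show ?thesis
    proof (cases "i \<in> {k, l, p, q}")
      case True
      then have "f (k, l) = \<zero>\<^bsub>dk K m\<^esub> \<or> f (p, q) = \<zero>\<^bsub>dk K m\<^esub>"
        by (auto simp: f_def)
      with 3 c show ?thesis by (auto simp: D.bracket_zero)
    next
      case False
      with 3 rl ri have "dk_t K m (relabel i k) (relabel i l) \<otimes>\<^bsub>dk K m\<^esub>
          dk_t K m (relabel i p) (relabel i q) = \<zero>\<^bsub>dk K m\<^esub>"
        by (intro dk_relations(3)[OF K]) auto
      with 3 False show ?thesis by (auto simp: f_def)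
    qed
  next
    case 4
    show ?thesis
    proof (cases "i \<in> {k, l, p}")
      case True
      then have "f (k, l) = \<zero>\<^bsub>dk K m\<^esub> \<or>
          f (k, p) = \<zero>\<^bsub>dk K m\<^esub> \<and> f (l, p) = \<zero>\<^bsub>dk K m\<^esub>"
        by (auto simp: f_def)
      with 4 c show ?thesis by (auto simp: D.bracket_zero)
    next
      case False
      with 4 rl ri have "dk_t K m (relabel i k) (relabel i l) \<otimes>\<^bsub>dk K m\<^esub>
          (dk_t K m (relabel i k) (relabel i p) \<oplus>\<^bsub>dk K m\<^esub>
           dk_t K m (relabel i l) (relabel i p)) = \<zero>\<^bsub>dk K m\<^esub>"
        by (intro dk_relations(4)[OF K]) auto
      with 4 False show ?thesis by (auto simp: f_def)
    qed
  qed
qed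

context
  fixes K :: "('k, 'm) ring_scheme" and i :: nat
  assumes K: "cring K" and i: "i \<in> {1..4}"
begin

interpretation K: cring K by (rule K)
interpretation D: lie_algebra K "dk K 4" by (rule lie_algebra_dk[OF K])
interpretation D': lie_algebra K "dk K 3" by (rule lie_algebra_dk[OF K])

abbreviation (input) "pr4_gen \<equiv> (\<lambda>(k, l). if k = i \<or> l = i then \<zero>\<^bsub>dk K 3\<^esub>
              else dk_t K 3 (relabel i k) (relabel i l))"

lemma four_minus_one: "4 - 1 = (3::nat)" by simp

lemma pr4: "pr4_gen \<in> dk_gens 4 \<rightarrow> carrier (dk K 3)"
   "\<forall>(s, t)\<in>dk_rels 4. lie_eval (dk K 3) pr4_gen s = lie_eval (dk K 3) pr4_gen t"
proof -
  show "pr4_gen \<in> dk_gens 4 \<rightarrow> carrier (dk K 3)"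
    by (rule Pi_I) (rule pr_gens_closed[OF K i, unfolded four_minus_one])
  show "\<forall>(s, t)\<in>dk_rels 4. lie_eval (dk K 3) pr4_gen s = lie_eval (dk K 3) pr4_gen t"
    by (rule ballI, rule case_prodI2, hypsubst) (rule pr_respects[OF K i, unfolded four_minus_one])
qed

lemma pr4_def: "pr K 4 i = lie_lift (dk K 3) pr4_gen"
  unfolding pr_def four_minus_one ..

lemmas hom4 = D'.lie_lift_hom[OF pr4, folded pr4_def dk_def]

lemma pr_hom:
  shows "pr K 4 i \<zero>\<^bsub>dk K 4\<^esub> = \<zero>\<^bsub>dk K 3\<^esub>"
    and "A \<in> carrier (dk K 4) \<Longrightarrow> pr K 4 i A \<in> carrier (dk K 3)"
    and "A \<in> carrier (dk K 4) \<Longrightarrow> B \<in> carrier (dk K 4) \<Longrightarrow>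
      pr K 4 i (A \<oplus>\<^bsub>dk K 4\<^esub> B) = pr K 4 i A \<oplus>\<^bsub>dk K 3\<^esub> pr K 4 i B"
    and "A \<in> carrier (dk K 4) \<Longrightarrow> B \<in> carrier (dk K 4) \<Longrightarrow>
      pr K 4 i (A \<otimes>\<^bsub>dk K 4\<^esub> B) = pr K 4 i A \<otimes>\<^bsub>dk K 3\<^esub> pr K 4 i B"
    and "a \<in> carrier K \<Longrightarrow> A \<in> carrier (dk K 4) \<Longrightarrow>
      pr K 4 i (a \<odot>\<^bsub>dk K 4\<^esub> A) = a \<odot>\<^bsub>dk K 3\<^esub> pr K 4 i A"
  by (fact hom4)+

lemma pr_minus: "A \<in> carrier (dk K 4) \<Longrightarrow> B \<in> carrier (dk K 4) \<Longrightarrow>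
      pr K 4 i (A \<ominus>\<^bsub>dk K 4\<^esub> B) = pr K 4 i A \<ominus>\<^bsub>dk K 3\<^esub> pr K 4 i B"
proof -
  assume AB: "A \<in> carrier (dk K 4)" "B \<in> carrier (dk K 4)"
  have e: "\<ominus>\<^bsub>dk K 4\<^esub> B = (\<ominus>\<^bsub>K\<^esub> \<one>\<^bsub>K\<^esub>) \<odot>\<^bsub>dk K 4\<^esub> B" using AB by (simp add: D.smult_l_minus)
  have "pr K 4 i (\<ominus>\<^bsub>dk K 4\<^esub> B) = \<ominus>\<^bsub>dk K 3\<^esub> pr K 4 i B"
    unfolding e using AB by (simp add: pr_hom D'.smult_l_minus)
  then show ?thesis using AB by (simp add: a_minus_def pr_hom)
qed

lemma pr_t:
  assumes "k \<in> {1..4}" "l \<in> {1..4}"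
  shows "pr K 4 i (dk_t K 4 k l) = (if k = i \<or> l = i then \<zero>\<^bsub>dk K 3\<^esub>
              else dk_t K 3 (relabel i k) (relabel i l))"
proof -
  have "Gen (k, l) \<in> lie_terms K (dk_gens 4)" using assms by (auto simp: dk_gens_def intro: lie_terms.intros)
  from D'.lie_lift_class[OF pr4 this] show ?thesis by (simp add: pr4_def dk_t_def)
qed

lemma pr_subst:
  assumes "\<phi> \<in> carrier (free_lie K)" and uv: "u \<in> carrier (dk K 4)" "v \<in> carrier (dk K 4)"
  shows "pr K 4 i (lie_subst (dk K 4) \<phi> u v) = lie_subst (dk K 3) \<phi> (pr K 4 i u) (pr K 4 i v)"
proof -
  obtain t where t: "t \<in> lie_terms K UNIV" "\<phi> = lie_class K UNIV {} t"
    using assms by (auto simp: free_lie_def carrier_presented_lie)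
  define f where "f = case_letter u v"
  define f' where "f' = case_letter (pr K 4 i u) (pr K 4 i v)"
  have f: "f g \<in> carrier (dk K 4)" for g using uv by (simp add: f_def split: letter.split)
  have f': "f' g \<in> carrier (dk K 3)" for g using uv by (simp add: f'_def pr_hom split: letter.split)
  have ff: "f' g = pr K 4 i (f g)" for g by (simp add: f_def f'_def split: letter.split)
  have "pr K 4 i (lie_eval (dk K 4) f t) = lie_eval (dk K 3) f' t"
    using t(1)
    by induction (auto simp: ff pr_hom D.lie_eval_closed[of UNIV f] f)
  moreover have "lie_lift (dk K 4) f \<phi> = lie_eval (dk K 4) f t"
    unfolding t(2) by (rule D.lie_lift_class) (use f t in auto)
  moreover have "lie_lift (dk K 3) f' \<phi> = lie_eval (dk K 3) f' t"
    unfolding t(2) by (rule D'.lie_lift_class) (use f' t in auto)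
  ultimately show ?thesis by (simp add: lie_subst_def f_def f'_def)
qed

end

lemma pr_pent:
  assumes K: "cring K" and i: "i \<in> {1..4}" and \<phi>: "\<phi> \<in> free_lie_ge K 2"
  shows "pent K \<phi> \<in> carrier (dk K 4)" "pr K 4 i (pent K \<phi>) = \<zero>\<^bsub>dk K 3\<^esub>"
proof -
  interpret K: cring K by (rule K)
  interpret D: lie_algebra K "dk K 4" by (rule lie_algebra_dk[OF K])
  interpret D': lie_algebra K "dk K 3" by (rule lie_algebra_dk[OF K])
  note pr = pr_minus[OF K] pr_hom[OF K] pr_subst[OF K] pr_t[OF K]
  have \<phi>': "\<phi> \<in> carrier (free_lie K)" using \<phi> D.free_lie_ge_closed by blast
  have t: "dk_t K 4 k l \<in> carrier (dk K 4)" if "k \<in> {1..4}" "l \<in> {1..4}" for k l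
    using that by (rule dk_t_closed)
  have t': "dk_t K 3 k l \<in> carrier (dk K 3)" if "k \<in> {1..3}" "l \<in> {1..3}" for k l
    using that by (rule dk_t_closed)
  note c = D.lie_subst_closed[OF _ _ \<phi>'] t
  note c' = D'.lie_subst_closed[OF _ _ \<phi>'] t'
  have nz: "\<ominus>\<^bsub>dk K 3\<^esub> \<zero>\<^bsub>dk K 3\<^esub> = \<zero>\<^bsub>dk K 3\<^esub>"
    using D'.r_neg[of "\<zero>\<^bsub>dk K 3\<^esub>"] by simp
  note van = D'.lie_subst_vanish[OF _ _ _ \<phi>]
  show "pent K \<phi> \<in> carrier (dk K 4)"
    by (simp add: pent_def Let_def c)
  have "i = 1 \<or> i = 2 \<or> i = 3 \<or> i = 4" using i by auto
  then show "pr K 4 i (pent K \<phi>) = \<zero>\<^bsub>dk K 3\<^esub>"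
    by (elim disjE; hypsubst)
      (simp_all del: One_nat_def add: pent_def Let_def pr \<phi>' c relabel_def c' van
        D'.r_neg D'.minus_eq D'.r_neg2 nz)
qed

lemma pent_in_brun4:
  assumes "cring K" "\<phi> \<in> free_lie_ge K 2"
  shows "pent K \<phi> \<in> carrier (brun4 K)"
  using pr_pent[OF assms(1) _ assms(2)] pr_pent(1)[OF assms(1) _ assms(2), of 1]
  by (auto simp: brun4_def brun_def a_kernel_def')

lemma brun_chain:
  "carrier (brun4 K) \<subseteq> carrier (brun13 K)" "carrier (brun13 K) \<subseteq> carrier (brun22 K)"
  by (auto simp: brun4_def brun13_def brun22_def brun_def)

end

theory Submission
  imports Defs
begin

text \<open>
  The class of v modulo \<open>\<Gamma>\<^sub>k(\<gg>)\<close> vanishes iff v lies in \<open>\<Gamma>\<^sub>k(\<gg>)\<close>. Hence all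
  implications reduce to the inclusions \<open>\<Gamma>\<^sub>k(\<gg>) \<subseteq> \<Gamma>\<^sub>k\<^sub>-\<^sub>1(\<gg>)\<close> and, for Lie
  subalgebras \<open>\<gg> \<subseteq> \<hh>\<close>, \<open>\<Gamma>\<^sub>k(\<gg>) \<subseteq> \<Gamma>\<^sub>k(\<hh>)\<close>, both shown by induction on k.
\<close>

context module
begin

text \<open>Closure under negation comes for free, since \<open>-u\<close> is the scalar multiple of
  \<open>u\<close> by \<open>-1\<close>. What remains are closure conditions that are easy to
  compare when the carrier of the ambient record is restricted.\<close>

lemma submodule_iff:
  "submodule H R M \<longleftrightarrow> H \<subseteq> carrier M \<and> \<zero>\<^bsub>M\<^esub> \<in> H \<and> (\<forall>u\<in>H. \<forall>v\<in>H. u \<oplus>\<^bsub>M\<^esub> v \<in> H) \<and>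
     (\<forall>a\<in>carrier R. \<forall>u\<in>H. a \<odot>\<^bsub>M\<^esub> u \<in> H)"
proof
  assume H: "submodule H R M"
  then have "\<zero>\<^bsub>M\<^esub> \<in> H"
    using subgroup.one_closed[OF submodule.axioms(1)[OF H]] by simp
  then show "H \<subseteq> carrier M \<and> \<zero>\<^bsub>M\<^esub> \<in> H \<and> (\<forall>u\<in>H. \<forall>v\<in>H. u \<oplus>\<^bsub>M\<^esub> v \<in> H) \<and>
     (\<forall>a\<in>carrier R. \<forall>u\<in>H. a \<odot>\<^bsub>M\<^esub> u \<in> H)"
    using submoduleE[OF H] by blast
next
  assume H: "H \<subseteq> carrier M \<and> \<zero>\<^bsub>M\<^esub> \<in> H \<and> (\<forall>u\<in>H. \<forall>v\<in>H. u \<oplus>\<^bsub>M\<^esub> v \<in> H) \<and>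
     (\<forall>a\<in>carrier R. \<forall>u\<in>H. a \<odot>\<^bsub>M\<^esub> u \<in> H)"
  show "submodule H R M"
  proof (rule submoduleI)
    fix u assume u: "u \<in> H"
    then have "\<ominus>\<^bsub>M\<^esub> u = (\<ominus>\<^bsub>R\<^esub> \<one>\<^bsub>R\<^esub>) \<odot>\<^bsub>M\<^esub> u"
      using H by (subst smult_l_minus) auto
    then show "\<ominus>\<^bsub>M\<^esub> u \<in> H" using H u by simp
  qed (use H in auto)
qed

lemma submodule_of_submodule_iff:
  assumes "submodule A R M"
  shows "submodule H R (M\<lparr>carrier := A\<rparr>) \<longleftrightarrow> submodule H R M \<and> H \<subseteq> A"
proof -
  interpret A: module R "M\<lparr>carrier := A\<rparr>"
    using assms module_axioms by (rule submodule.submodule_is_module)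
  show ?thesis
    unfolding A.submodule_iff submodule_iff using assms by (auto simp: submodule_iff)
qed

text \<open>The coset of \<open>v\<close> always contains \<open>v\<close>, which settles one
  direction; a coset of a member of \<open>H\<close> is \<open>H\<close> itself, which settles the
  other.\<close>

lemma submodule_coset_eq_iff:
  assumes H: "submodule H R M" and v: "v \<in> carrier M"
  shows "H +>\<^bsub>M\<^esub> v = H \<longleftrightarrow> v \<in> H"
proof -
  interpret H: abelian_subgroup H M
    using submodule.axioms(1)[OF H]
    by (intro abelian_subgroupI3 additive_subgroup.intro abelian_group_axioms)
  show ?thesis using H.a_rcos_self[OF v] H.a_rcos_const by auto
qed

end

context
  fixes R :: "('k, 'm) ring_scheme" and M :: "('k, 'v) module"
  assumes M: "module R M"
begin

interpretation module R M by (rule M)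

text \<open>An intersection of submodules is closed under the operations. The hypothesis on
  \<open>S\<close> makes \<open>carrier M\<close> one of the sets intersected, so that the hull
  stays inside it.\<close>

lemma submodule_span_in:
  assumes "S \<subseteq> carrier M"
  shows "submodule (span_in R M S) R M"
proof -
  have "span_in R M S \<subseteq> carrier M"
    unfolding span_in_def using assms carrier_is_submodule by (rule hull_minimal)
  then show ?thesis
    unfolding submodule_iff by (auto simp: span_in_def hull_def submodule_iff)
qed

text \<open>The lower central series of a subalgebra is built from spans in a record with restricted
  carrier. This lemma moves such spans into the ambient module, where the series of different
  subalgebras can be compared.\<close>

lemma span_in_submodule:
  assumes A: "submodule A R M" and S: "S \<subseteq> A"
  shows "span_in R (M\<lparr>carrier := A\<rparr>) S = span_in R M S"
proof
  have "S \<subseteq> carrier M" using A S by (auto simp: submodule_iff)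
  then have "submodule (span_in R M S) R M" by (rule submodule_span_in)
  moreover have "span_in R M S \<subseteq> A"
    unfolding span_in_def using S A by (rule hull_minimal)
  ultimately show "span_in R (M\<lparr>carrier := A\<rparr>) S \<subseteq> span_in R M S"
    unfolding span_in_def[of _ "M\<lparr>carrier := A\<rparr>"]
    by (intro hull_minimal) (auto simp: submodule_of_submodule_iff[OF A] span_in_def hull_inc)
  \<comment> \<open>Every submodule of \<open>A\<close> is a submodule of \<open>M\<close>, so the
    hull on the right intersects a subfamily of the sets used on the left.\<close>
  show "span_in R M S \<subseteq> span_in R (M\<lparr>carrier := A\<rparr>) S"
    unfolding span_in_def using A by (intro hull_antimono) (simp add: submodule_of_submodule_iff)
qed

end

context lie_algebra
begin

lemma lower_central_submodule: "submodule (lower_central K L k) K L"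
proof (induction k)
  case 0
  show ?case by (simp add: carrier_is_submodule)
next
  case (Suc k)
  then have "{u \<otimes>\<^bsub>L\<^esub> v |u v. u \<in> carrier L \<and> v \<in> lower_central K L k} \<subseteq> carrier L"
    by (auto simp: submodule_iff intro!: bracket_closed)
  then show ?case by (simp add: bracket_span_def submodule_span_in[OF module_axioms])
qed

lemma lower_central_subset: "lower_central K L k \<subseteq> carrier L"
  using lower_central_submodule[of k] by (simp add: submodule_iff)

text \<open>The span of brackets is monotone in its second argument, so each inclusion yields the
  next one. The induction starts because the term of index 0 is the whole algebra.\<close>

lemma lower_central_Suc_subset: "lower_central K L (Suc k) \<subseteq> lower_central K L k"
proof (induction k)
  case 0
  show ?case using lower_central_subset[of "Suc 0"] by simp
next
  case (Suc k)
  then show ?case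
    unfolding lower_central.simps(2)[of _ _ "Suc k"] lower_central.simps(2)[of _ _ k]
      bracket_span_def span_in_def
    by (intro hull_mono) auto
qed

text \<open>The zero of \<open>lie_quot\<close> is the submodule factored out, so vanishing of a
  class is the coset equation of \<open>submodule_coset_eq_iff\<close>.\<close>

lemma central_class_eq_zero_iff:
  "v \<in> carrier L \<Longrightarrow>
    central_class K L k v = \<zero>\<^bsub>central_quot K L k\<^esub> \<longleftrightarrow> v \<in> lower_central K L k"
  using submodule_coset_eq_iff[OF lower_central_submodule]
  by (simp add: central_class_def central_quot_def lie_quot_def)

lemma lie_algebra_subalgebra:
  assumes A: "submodule A K L" and "\<And>u v. u \<in> A \<Longrightarrow> v \<in> A \<Longrightarrow> u \<otimes>\<^bsub>L\<^esub> v \<in> A"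
  shows "lie_algebra K (L\<lparr>carrier := A\<rparr>)"
proof -
  have "u \<in> carrier L" if "u \<in> A" for u using A that by (auto simp: submodule_iff)
  then show ?thesis
    using assms(2) submodule.submodule_is_module[OF A module_axioms]
    by (auto simp: lie_algebra_def lie_algebra_axioms_def bracket_add_left bracket_add_right
        bracket_smult_left bracket_smult_right bracket_self jacobi)
qed

text \<open>The two series are spans in different records. Once both are rewritten as spans in
  \<open>L\<close>, the induction step is monotonicity of the hull.\<close>

lemma lower_central_mono:
  assumes A: "submodule A K L" "\<And>u v. u \<in> A \<Longrightarrow> v \<in> A \<Longrightarrow> u \<otimes>\<^bsub>L\<^esub> v \<in> A"
    and B: "submodule B K L" "\<And>u v. u \<in> B \<Longrightarrow> v \<in> B \<Longrightarrow> u \<otimes>\<^bsub>L\<^esub> v \<in> B"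
    and AB: "A \<subseteq> B"
  shows "lower_central K (L\<lparr>carrier := A\<rparr>) k \<subseteq> lower_central K (L\<lparr>carrier := B\<rparr>) k"
proof (induction k)
  case 0
  show ?case using AB by simp
next
  case (Suc k)
  interpret A: lie_algebra K "L\<lparr>carrier := A\<rparr>" using A by (rule lie_algebra_subalgebra)
  interpret B: lie_algebra K "L\<lparr>carrier := B\<rparr>" using B by (rule lie_algebra_subalgebra)
  let ?S = "\<lambda>C. {u \<otimes>\<^bsub>L\<^esub> v |u v. u \<in> C \<and> v \<in> lower_central K (L\<lparr>carrier := C\<rparr>) k}"
  \<comment> \<open>Closure of \<open>A\<close> and \<open>B\<close> under the bracket keeps the
    generators inside them, as \<open>span_in_submodule\<close> requires.\<close>
  have "?S A \<subseteq> A" using A.lower_central_subset[of k] A(2) by auto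
  moreover have "?S B \<subseteq> B" using B.lower_central_subset[of k] B(2) by auto
  moreover have "span_in K L (?S A) \<subseteq> span_in K L (?S B)"
    unfolding span_in_def using Suc AB by (intro hull_mono) blast
  ultimately show ?case
    using A(1) B(1) by (simp add: bracket_span_def span_in_submodule[OF module_axioms])
qed

end

lemma
  assumes K: "cring K" and I: "I \<subseteq> {1..4}" "I \<noteq> {}"
  shows brun_submodule: "submodule (carrier (brun K I)) K (dk K 4)"
    and brun_bracket_closed: "\<lbrakk>u \<in> carrier (brun K I); v \<in> carrier (brun K I)\<rbrakk>
      \<Longrightarrow> u \<otimes>\<^bsub>dk K 4\<^esub> v \<in> carrier (brun K I)"
proof -
  interpret D: lie_algebra K "dk K 4" by (rule lie_algebra_dk[OF K])
  interpret D': lie_algebra K "dk K 3" by (rule lie_algebra_dk[OF K])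
  have i: "i \<in> {1..4}" if "i \<in> I" for i using I that by blast
  \<comment> \<open>Nonemptiness of \<open>I\<close> matters here: an empty intersection of kernels
    would be the whole type instead of the carrier of \<open>dk K 4\<close>.\<close>
  have c: "carrier (brun K I) = {u \<in> carrier (dk K 4). \<forall>i\<in>I. pr K 4 i u = \<zero>\<^bsub>dk K 3\<^esub>}"
    using I(2) by (auto simp: brun_def a_kernel_def')
  show "submodule (carrier (brun K I)) K (dk K 4)"
    unfolding c D.submodule_iff using pr_hom[OF K i] by auto
  show "u \<otimes>\<^bsub>dk K 4\<^esub> v \<in> carrier (brun K I)"
    if "u \<in> carrier (brun K I)" "v \<in> carrier (brun K I)"
    using that unfolding c using pr_hom(4)[OF K i]
    by (auto simp: D.bracket_closed D'.bracket_zero)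
qed

text \<open>Puts \<open>brun K I\<close> into the record-update form in which the subalgebra lemmas
  are stated.\<close>

lemma brun_eq: "brun K I = (dk K 4)\<lparr>carrier := carrier (brun K I)\<rparr>"
  by (simp add: brun_def)

lemma lie_algebra_brun:
  assumes "cring K" "I \<subseteq> {1..4}" "I \<noteq> {}"
  shows "lie_algebra K (brun K I)"
  using lie_algebra.lie_algebra_subalgebra[OF lie_algebra_dk brun_submodule brun_bracket_closed] assms
  by (metis brun_eq)

lemma lower_central_brun_mono:
  assumes K: "cring K" and I: "I \<subseteq> {1..4}" and J: "J \<noteq> {}" "J \<subseteq> I"
  shows "lower_central K (brun K I) k \<subseteq> lower_central K (brun K J) k"
proof -
  have I': "I \<noteq> {}" and J': "J \<subseteq> {1..4}" using I J by auto
  have "carrier (brun K I) \<subseteq> carrier (brun K J)" using J by (auto simp: brun_def)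
  then show ?thesis
    using lie_algebra.lower_central_mono[OF lie_algebra_dk[OF K]
        brun_submodule[OF K I I'] brun_bracket_closed[OF K I I']
        brun_submodule[OF K J' J(1)] brun_bracket_closed[OF K J' J(1)]]
    by (metis brun_eq)
qed

theorem theorem1p1:
  fixes K :: "('k, 'm) ring_scheme"
    and \<phi> :: "('k, letter) lie_term set"
    and k :: nat
  assumes "field K"
    and char_0: "\<And>n::nat. n > 0 \<Longrightarrow> [n] \<cdot>\<^bsub>K\<^esub> \<one>\<^bsub>K\<^esub> \<noteq> \<zero>\<^bsub>K\<^esub>"
    and "\<phi> \<in> free_lie_ge K 3"
    and "k > 1"
  shows
    "((pent K \<phi> = \<zero>\<^bsub>dk K 4\<^esub> \<longrightarrow> pent_k K k \<phi> = \<zero>\<^bsub>central_quot K (brun4 K) k\<^esub>) \<and>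
      (pent_k K k \<phi> = \<zero>\<^bsub>central_quot K (brun4 K) k\<^esub> \<longrightarrow>
        pent_k K (k - 1) \<phi> = \<zero>\<^bsub>central_quot K (brun4 K) (k - 1)\<^esub>)) \<and>
     (pent_dmr K k \<phi> = \<zero>\<^bsub>central_quot K (brun13 K) k\<^esub> \<longrightarrow>
        pent_dmr K (k - 1) \<phi> = \<zero>\<^bsub>central_quot K (brun13 K) (k - 1)\<^esub>) \<and>
     (pent_krv K k \<phi> = \<zero>\<^bsub>central_quot K (brun22 K) k\<^esub> \<longrightarrow>
        pent_krv K (k - 1) \<phi> = \<zero>\<^bsub>central_quot K (brun22 K) (k - 1)\<^esub>) \<and>
     ((pent_k K k \<phi> = \<zero>\<^bsub>central_quot K (brun4 K) k\<^esub> \<longrightarrow>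
        pent_dmr K k \<phi> = \<zero>\<^bsub>central_quot K (brun13 K) k\<^esub>) \<and>
      (pent_dmr K k \<phi> = \<zero>\<^bsub>central_quot K (brun13 K) k\<^esub> \<longrightarrow>
        pent_krv K k \<phi> = \<zero>\<^bsub>central_quot K (brun22 K) k\<^esub>))"
proof -
  interpret field K by fact
  note K = is_cring
  \<comment> \<open>With \<open>k = Suc j\<close> the index \<open>k - 1\<close> is
    \<open>j\<close>, so the passage from \<open>k\<close> to \<open>k - 1\<close> is one step down
    the series.\<close>
  obtain j where j: "k = Suc j" using \<open>k > 1\<close> by (cases k) auto
  interpret D: lie_algebra K "dk K 4" by (rule lie_algebra_dk[OF K])
  interpret B4: lie_algebra K "brun4 K"
    unfolding brun4_def by (rule lie_algebra_brun[OF K]) auto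
  interpret B13: lie_algebra K "brun13 K"
    unfolding brun13_def by (rule lie_algebra_brun[OF K]) auto
  interpret B22: lie_algebra K "brun22 K"
    unfolding brun22_def by (rule lie_algebra_brun[OF K]) auto
  \<comment> \<open>Degree at least 2 is the condition under which \<open>pent_in_brun4\<close>
    places \<open>pent K \<phi>\<close> in the smallest of the three subalgebras.\<close>
  have "\<phi> \<in> free_lie_ge K 2"
    using \<open>\<phi> \<in> free_lie_ge K 3\<close> D.free_lie_ge_antimono[of 2 3] by auto
  then have p4: "pent K \<phi> \<in> carrier (brun4 K)" by (rule pent_in_brun4[OF K])
  then have p13: "pent K \<phi> \<in> carrier (brun13 K)" and p22: "pent K \<phi> \<in> carrier (brun22 K)"
    using brun_chain[of K] by auto
  note iff = pent_k_def pent_dmr_def pent_krv_def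
    B4.central_class_eq_zero_iff[OF p4] B13.central_class_eq_zero_iff[OF p13]
    B22.central_class_eq_zero_iff[OF p22]
  \<comment> \<open>This gives the first implication of (1); \<open>brun4 K\<close> shares its zero
    with \<open>dk K 4\<close>.\<close>
  have "\<zero>\<^bsub>dk K 4\<^esub> \<in> lower_central K (brun4 K) k"
    proof -
    have "\<zero>\<^bsub>brun4 K\<^esub> = \<zero>\<^bsub>dk K 4\<^esub>" by (simp add: brun4_def brun_def)
    then show ?thesis using B4.lower_central_submodule[of k] by (simp add: B4.submodule_iff)
  qed
  moreover have "lower_central K (brun4 K) k \<subseteq> lower_central K (brun13 K) k"
    unfolding brun4_def brun13_def by (rule lower_central_brun_mono[OF K]) auto
  moreover have "lower_central K (brun13 K) k \<subseteq> lower_central K (brun22 K) k"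
    unfolding brun13_def brun22_def by (rule lower_central_brun_mono[OF K]) auto
  \<comment> \<open>The two inclusions between series give (4); the descent within each series gives
    (2), (3) and the second implication of (1). The recursion equations stay folded so that terms of
    index \<open>Suc j\<close> match the descent facts.\<close>
  ultimately show ?thesis
    using B4.lower_central_Suc_subset[of j] B13.lower_central_Suc_subset[of j]
      B22.lower_central_Suc_subset[of j]
    unfolding iff by (auto simp: j simp del: lower_central.simps)
qed

end
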